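(* Let $\mathbb{F}$ be an algebraically closed field, $V=\mathbb{F}^n$, $R=\mathbb{F}[V]$, and let $W\subset\mathrm{GL}(V)$ be a finite pseudo-reflection group with $|W|\in\mathbb{F}^\times$. Let $(\Gamma_W,\alpha_W,\tau_W)$ be the linear hypergraph associated to $W$. Then, as subsets of $\mathrm{Maps}(W,R)$, $$\mathcal{H}_W=H(\Gamma_W,\alpha_W,\tau_W).$$
   Context: $R=\mathbb{F}[V]$ is the ring of polynomial functions on $V$; $W$ acts on $R$ by $(w\cdot f)(v)=f(w^{-1}v)$, and $w(f)$ denotes $w\cdot f$. A pseudo-reflection is a non-identity element $s\in W$ whose fixed subspace in $V$ is a hyperplane $H_s$; a pseudo-reflection group is a group generated by pseudo-reflections. $s(W)$ is the set of pseudo-reflections in $W$ and $|s|$ is the order of $s$. For each $s\in s(W)$ a co-root $\ell_s\in V^*$ (a non-zero linear function vanishing on $H_s$) is chosen and fixed, and $L_s\colon W\to R$ is $L_s(x)=x(\ell_s)$. For a set $X$, $\mathrm{Maps}(X,R)$ is the ring of all maps $X\to R$ with pointwise operations; it is an $R$-algebra with $R$ embedded as the constant maps. $\mathcal{H}_W$ is the set of all $F\colon W\to R$ such that $\sum_{j=0}^{|s|-1}\frac{F(xs^j)}{L_s(xs^j)^i}$ (computed in $\mathrm{Quot}(R)$) lies in $R$ for all $x\in W$, all $s\in s(W)$ and all integers $i\le |s|-1$. Linear hypergraphs: a hypergraph $\Gamma=(\mathcal{V},\mathcal{E})$ is a finite set $\mathcal{V}$ of vertices with a collection $\mathcal{E}$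 of subsets of $\mathcal{V}$, called hyperedges; for $e\in\mathcal{E}$, $\mathcal{V}_e\subset\mathcal{V}$ is its vertex set and $|e|$ its number of vertices. An axial function is a map $\alpha\colon\mathcal{E}\to\mathbb{P}(V^* )$ assigning to each hyperedge a one-dimensional linear subspace of $V^*$. A generating class for $e$ is an injective map $\tau_e\colon\mathcal{V}_e\to\alpha(e)$. With $\tau=\{\tau_e\}_{e\in\mathcal{E}}$, the triple $(\Gamma,\alpha,\tau)$ is a linear hypergraph. The equivariant cohomology of a hyperedge is $$H(e,\tau_e)=\left\{G\colon\mathcal{V}_e\to R\ \left|\ G=\sum_{i=0}^{|e|-1}g_i\,\tau_e^i\ \text{for some constants } g_i\in R\right.\right\},$$ and the equivariant cohomology of the linear hypergraph is $$H(\Gamma,\alpha,\tau)=\{F\colon\mathcal{V}\to R\mid \rho_e(F)\in H(e,\tau_e)\text{ for each } e\in\mathcal{E}\},$$ where $\rho_e\colon\mathrm{Maps}(\mathcal{V},R)\to\mathrm{Maps}(\mathcal{V}_e,R)$ is restriction. The linear hypergraph of $W$: $\Gamma_W=(\mathcal{V}_W,\mathcal{E}_W)$ with $\mathcal{V}_W=W$ and $\mathcal{E}_W=\{\mathfrak{o}_s(x)\mid s\in s(W),\ x\in W\}$, where $\mathfrak{o}_s(x)=\{x,xs,\dots,xs^{|s|-1}\}$ is the right $s$-orbit of $x$; $\alpha_W(\mathfrak{o}_s(x))=\mathbb{F}\cdot x(\ell_s)$; and for $e=\mathfrak{o}_s(x)$ the generating class $\tau_e$ is the restriction of $L_s$ to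 $\mathfrak{o}_s(x)$, with $\tau_W=\{\tau_e\}_{e\in\mathcal{E}_W}$. (If $\mathfrak{o}_s(x)=\mathfrak{o}_{s'}(x')$ as sets, then $s,s'$ generate the same cyclic group and $L_s,L_{s'}$ differ by a non-zero scalar, so $H(e,\tau_e)$ does not depend on which presentation of the hyperedge is used.) *)

theory Defs
  imports
    "HOL-Analysis.Analysis"
    "HOL-Computational_Algebra.Computational_Algebra"
    "HOL-Algebra.Generated_Groups"
    "HOL-Algebra.Multiplicative_Group"
begin

section \<open>The ring of polynomial functions on affine space\<close>

inductive polynomial_fun :: "('a::comm_ring_1 ^ 'n::finite \<Rightarrow> 'a) \<Rightarrow> bool" where
  const: "polynomial_fun (\<lambda>v. c)"
| coord: "polynomial_fun (\<lambda>v. v $ i)"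
| add: "polynomial_fun f \<Longrightarrow> polynomial_fun g \<Longrightarrow> polynomial_fun (\<lambda>v. f v + g v)"
| mult: "polynomial_fun f \<Longrightarrow> polynomial_fun g \<Longrightarrow> polynomial_fun (\<lambda>v. f v * g v)"

typedef (overloaded) ('a::comm_ring_1, 'n::finite) polyfun =
  "{f :: 'a ^ 'n \<Rightarrow> 'a. polynomial_fun f}"
  morphisms eval_polyfun Abs_polyfun
  using polynomial_fun.const by blast

setup_lifting type_definition_polyfun

lift_definition const_polyfun :: "'a \<Rightarrow> ('a::comm_ring_1, 'n::finite) polyfun"
  is "\<lambda>c v. c" by (rule polynomial_fun.const)

instantiation polyfun :: (comm_ring_1, finite) comm_ring_1
begin

lift_definition zero_polyfun :: "('a, 'b) polyfun" is "\<lambda>v. 0"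
  by (rule polynomial_fun.const)

lift_definition one_polyfun :: "('a, 'b) polyfun" is "\<lambda>v. 1"
  by (rule polynomial_fun.const)

lift_definition plus_polyfun :: "('a, 'b) polyfun \<Rightarrow> ('a, 'b) polyfun \<Rightarrow> ('a, 'b) polyfun"
  is "\<lambda>f g v. f v + g v" by (rule polynomial_fun.add)

lift_definition times_polyfun :: "('a, 'b) polyfun \<Rightarrow> ('a, 'b) polyfun \<Rightarrow> ('a, 'b) polyfun"
  is "\<lambda>f g v. f v * g v" by (rule polynomial_fun.mult)

lift_definition uminus_polyfun :: "('a, 'b) polyfun \<Rightarrow> ('a, 'b) polyfun"
  is "\<lambda>f v. - f v"
  using polynomial_fun.mult[OF polynomial_fun.const[of "- 1"]] by simp

lift_definition minus_polyfun :: "('a, 'b) polyfun \<Rightarrow> ('a, 'b) polyfun \<Rightarrow> ('a, 'b) polyfun"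
  is "\<lambda>f g v. f v - g v"
  using polynomial_fun.add[OF _ polynomial_fun.mult[OF polynomial_fun.const[of "- 1"]]] by simp

instance
  by standard (transfer; simp add: algebra_simps fun_eq_iff)+

end

lemma infinite_UNIV_alg_closed: "infinite (UNIV :: 'a::alg_closed_field set)"
proof
  assume fin: "finite (UNIV :: 'a set)"
  define q :: "'a poly" where "q = (\<Prod>a\<in>UNIV. [:- a, 1:])"
  have deg: "degree q = card (UNIV :: 'a set)"
    unfolding q_def by (subst degree_prod_sum_eq) auto
  then have "degree q > 0"
    using fin by (simp add: card_gt_0_iff)
  then have "degree (q + 1) > 0"
    by (subst degree_add_eq_left) auto
  then obtain x where "poly (q + 1) x = 0"
    using alg_closed_imp_poly_has_root by blast
  moreover have "poly q x = 0"
    unfolding q_def poly_prod using fin by auto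
  ultimately show False by simp
qed

lemma polynomial_fun_line:
  fixes f :: "'a::comm_ring_1 ^ 'n::finite \<Rightarrow> 'a"
  assumes "polynomial_fun f"
  shows "\<exists>p. \<forall>t. f (v + t *s w) = poly p t"
  using assms
proof induction
  case (const c)
  show ?case by (intro exI[of _ "[:c:]"]) simp
next
  case (coord i)
  show ?case by (intro exI[of _ "[:v $ i, w $ i:]"]) simp
next
  case (add f g)
  then show ?case by (metis poly_add)
next
  case (mult f g)
  then show ?case by (metis poly_mult)
qed

instance polyfun :: (alg_closed_field, finite) idom
proof
  fix f g :: "('a, 'b) polyfun"
  assume "f \<noteq> 0" "g \<noteq> 0"
  then obtain v w where v: "eval_polyfun f v \<noteq> 0" and w: "eval_polyfun g w \<noteq> 0"
    by (metis eval_polyfun_inject ext zero_polyfun.rep_eq)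
  have "\<exists>p. \<forall>t. eval_polyfun h (v + t *s (w - v)) = poly p t" for h :: "('a, 'b) polyfun"
    using polynomial_fun_line eval_polyfun by blast
  then obtain p q where p: "\<And>t. eval_polyfun f (v + t *s (w - v)) = poly p t"
    and q: "\<And>t. eval_polyfun g (v + t *s (w - v)) = poly q t"
    by metis
  have "poly p 0 \<noteq> 0" using p[of 0] v by simp
  moreover have "poly q 1 \<noteq> 0" using q[of 1] w by simp
  ultimately have "p * q \<noteq> 0" by auto
  then have "finite {t. poly (p * q) t = 0}" by (rule poly_roots_finite)
  then obtain t where "poly (p * q) t \<noteq> 0"
    using infinite_UNIV_alg_closed[where 'a = 'a] by (metis (mono_tags) UNIV_eq_I mem_Collect_eq)
  then have "eval_polyfun (f * g) (v + t *s (w - v)) \<noteq> 0"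
    by (simp only: times_polyfun.rep_eq p q poly_mult not_False_eq_True)
  then show "f * g \<noteq> 0" by (auto simp: zero_polyfun.rep_eq)
qed

text \<open>\<open>R\<close> inside its field of fractions.\<close>

definition integral_fracts :: "'r::idom fract set" where
  "integral_fracts = range (\<lambda>r. Fract r 1)"

text \<open>The dual space and its projectivization, both realized inside the ring of polynomial
  functions.\<close>

definition dual_space :: "('a::field, 'n::finite) polyfun set" where
  "dual_space = {f. Vector_Spaces.linear (*s) (*) (eval_polyfun f)}"

definition scalar_line :: "('a::field, 'n::finite) polyfun \<Rightarrow> ('a, 'n) polyfun set" where
  "scalar_line f = range (\<lambda>c. const_polyfun c * f)"

definition proj_dual :: "('a::field, 'n::finite) polyfun set set" where
  "proj_dual = scalar_line ` (dual_space - {0})"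

definition Maps :: "'v set \<Rightarrow> 'r set \<Rightarrow> ('v \<Rightarrow> 'r) set" where
  "Maps X R = X \<rightarrow>\<^sub>E R"


section \<open>Pseudo-reflection groups\<close>

definition GL :: "('a::field ^ 'n::finite ^ 'n) monoid" where
  "GL = \<lparr>carrier = {A. invertible A}, monoid.mult = (**), one = mat 1\<rparr>"

definition fixed_space :: "'a::field ^ 'n::finite ^ 'n \<Rightarrow> ('a ^ 'n) set" where
  "fixed_space s = {v. s *v v = v}"

definition pseudo_reflections ::
  "('a::field ^ 'n::finite ^ 'n) set \<Rightarrow> ('a ^ 'n ^ 'n) set" where
  "pseudo_reflections W = {s \<in> W. s \<noteq> mat 1 \<and> vec.dim (fixed_space s) + 1 = CARD('n)}"

definition pseudo_reflection_group :: "('a::field ^ 'n::finite ^ 'n) set \<Rightarrow> bool" where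
  "pseudo_reflection_group W \<longleftrightarrow> subgroup W GL \<and> generate GL (pseudo_reflections W) = W"

abbreviation refl_ord :: "'a::field ^ 'n::finite ^ 'n \<Rightarrow> nat" where
  "refl_ord s \<equiv> group.ord GL s"

text \<open>The action \<open>(w \<cdot> f)(v) = f (w\<^sup>-\<^sup>1 v)\<close>.\<close>

lemma polynomial_fun_sum:
  "(\<And>i. i \<in> I \<Longrightarrow> polynomial_fun (f i)) \<Longrightarrow> polynomial_fun (\<lambda>v. \<Sum>i\<in>I. f i v)"
  by (induction I rule: infinite_finite_induct)
     (auto intro: polynomial_fun.const polynomial_fun.add)

lemma polynomial_fun_compose_matrix:
  fixes f :: "'a::comm_ring_1 ^ 'n::finite \<Rightarrow> 'a" and A :: "'a ^ 'm::finite ^ 'n"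
  assumes "polynomial_fun f"
  shows "polynomial_fun (\<lambda>v. f (A *v v))"
  using assms
proof induction
  case (coord i)
  show ?case
    unfolding matrix_vector_mult_def
    by (auto intro!: polynomial_fun_sum polynomial_fun.intros)
qed (auto intro: polynomial_fun.intros)

lift_definition act ::
  "'a::field ^ 'n::finite ^ 'n \<Rightarrow> ('a, 'n) polyfun \<Rightarrow> ('a, 'n) polyfun"
  is "\<lambda>w f v. f (matrix_inv w *v v)"
  by (rule polynomial_fun_compose_matrix)

definition coroots ::
  "('a::field ^ 'n::finite ^ 'n) set \<Rightarrow> ('a ^ 'n ^ 'n \<Rightarrow> ('a, 'n) polyfun) \<Rightarrow> bool" where
  "coroots W l \<longleftrightarrow> (\<forall>s \<in> pseudo_reflections W.
     l s \<in> dual_space - {0} \<and> (\<forall>v \<in> fixed_space s. eval_polyfun (l s) v = 0))"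

definition L ::
  "('a::field ^ 'n::finite ^ 'n \<Rightarrow> ('a, 'n) polyfun)
    \<Rightarrow> 'a ^ 'n ^ 'n \<Rightarrow> 'a ^ 'n ^ 'n \<Rightarrow> ('a, 'n) polyfun" where
  "L l s x = act x (l s)"

text \<open>The exponent \<open>i\<close> below ranges over all integers, negative ones included.\<close>

definition HW ::
  "('a::alg_closed_field ^ 'n::finite ^ 'n) set \<Rightarrow> ('a ^ 'n ^ 'n \<Rightarrow> ('a, 'n) polyfun)
    \<Rightarrow> ('a ^ 'n ^ 'n \<Rightarrow> ('a, 'n) polyfun) set" where
  "HW W l = {F \<in> Maps W UNIV. \<forall>x \<in> W. \<forall>s \<in> pseudo_reflections W. \<forall>i::int.
     i \<le> int (refl_ord s) - 1 \<longrightarrow>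
     (\<Sum>j<refl_ord s. Fract (F (x \<otimes>\<^bsub>GL\<^esub> (s [^]\<^bsub>GL\<^esub> j))) 1
        / Fract (L l s (x \<otimes>\<^bsub>GL\<^esub> (s [^]\<^bsub>GL\<^esub> j))) 1 powi i) \<in> integral_fracts}"


section \<open>Linear hypergraphs\<close>

record (overloaded) ('v, 'a, 'n) linear_hypergraph_data =
  vertices :: "'v set"
  hyperedges :: "'v set set"
  axial :: "'v set \<Rightarrow> ('a::field, 'n::finite) polyfun set"
  gen_class :: "'v set \<Rightarrow> 'v \<Rightarrow> ('a, 'n) polyfun"

definition linear_hypergraph :: "('v, 'a::field, 'n::finite) linear_hypergraph_data \<Rightarrow> bool" where
  "linear_hypergraph \<Gamma> \<longleftrightarrow> finite (vertices \<Gamma>) \<and> hyperedges \<Gamma> \<subseteq> Pow (vertices \<Gamma>) \<and>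
     (\<forall>e \<in> hyperedges \<Gamma>. axial \<Gamma> e \<in> proj_dual \<and>
        gen_class \<Gamma> e \<in> Maps e (axial \<Gamma> e) \<and> inj_on (gen_class \<Gamma> e) e)"

definition edge_cohomology ::
  "'v set \<Rightarrow> ('v \<Rightarrow> 'r::comm_ring_1) \<Rightarrow> ('v \<Rightarrow> 'r) set" where
  "edge_cohomology e t = {G \<in> Maps e UNIV.
     \<exists>g :: nat \<Rightarrow> 'r. \<forall>v \<in> e. G v = (\<Sum>i<card e. g i * t v ^ i)}"

definition hypergraph_cohomology ::
  "('v, 'a::field, 'n::finite) linear_hypergraph_data \<Rightarrow> ('v \<Rightarrow> ('a, 'n) polyfun) set" where
  "hypergraph_cohomology \<Gamma> = {F \<in> Maps (vertices \<Gamma>) UNIV.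
     \<forall>e \<in> hyperedges \<Gamma>. restrict F e \<in> edge_cohomology e (gen_class \<Gamma> e)}"


section \<open>The linear hypergraph of a pseudo-reflection group\<close>

definition right_orbit ::
  "'a::field ^ 'n::finite ^ 'n \<Rightarrow> 'a ^ 'n ^ 'n \<Rightarrow> ('a ^ 'n ^ 'n) set" where
  "right_orbit s x = (\<lambda>j::nat. x \<otimes>\<^bsub>GL\<^esub> (s [^]\<^bsub>GL\<^esub> j)) ` {..<refl_ord s}"

definition W_hyperedges ::
  "('a::field ^ 'n::finite ^ 'n) set \<Rightarrow> ('a ^ 'n ^ 'n) set set" where
  "W_hyperedges W = {right_orbit s x | s x. s \<in> pseudo_reflections W \<and> x \<in> W}"

text \<open>The same hyperedge can be presented as \<open>right_orbit s x\<close> in several ways, and the generating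
  class (though not the cohomology) depends on the presentation. So the hypergraph is formed
  relative to a choice \<open>p\<close> of a presentation \<open>p e = (s, x)\<close> for every hyperedge \<open>e\<close>.\<close>

definition orbit_presentation ::
  "('a::field ^ 'n::finite ^ 'n) set
    \<Rightarrow> (('a ^ 'n ^ 'n) set \<Rightarrow> ('a ^ 'n ^ 'n) \<times> ('a ^ 'n ^ 'n)) \<Rightarrow> bool" where
  "orbit_presentation W p \<longleftrightarrow> (\<forall>e \<in> W_hyperedges W.
     case p e of (s, x) \<Rightarrow> s \<in> pseudo_reflections W \<and> x \<in> W \<and> e = right_orbit s x)"

definition W_hypergraph ::
  "('a::field ^ 'n::finite ^ 'n) set \<Rightarrow> ('a ^ 'n ^ 'n \<Rightarrow> ('a, 'n) polyfun)
    \<Rightarrow> (('a ^ 'n ^ 'n) set \<Rightarrow> ('a ^ 'n ^ 'n) \<times> ('a ^ 'n ^ 'n))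
    \<Rightarrow> ('a ^ 'n ^ 'n, 'a, 'n) linear_hypergraph_data" where
  "W_hypergraph W l p = \<lparr>
     vertices = W,
     hyperedges = W_hyperedges W,
     axial = (\<lambda>e. case p e of (s, x) \<Rightarrow> scalar_line (act x (l s))),
     gen_class = (\<lambda>e. case p e of (s, x) \<Rightarrow> restrict (L l s) e)\<rparr>"

lemma GL_simps [simp]:
  "x \<in> carrier GL \<longleftrightarrow> invertible x" "x \<otimes>\<^bsub>GL\<^esub> y = x ** y" "\<one>\<^bsub>GL\<^esub> = mat 1"
  by (simp_all add: GL_def)

lemma group_GL: "group (GL :: ('a::field ^ 'n::finite ^ 'n) monoid)"
proof (rule groupI)
  fix x :: "'a ^ 'n ^ 'n"
  assume "x \<in> carrier GL"
  then obtain y where "x ** y = mat 1" "y ** x = mat 1"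
    by (auto simp: invertible_def)
  then show "\<exists>y \<in> carrier GL. y \<otimes>\<^bsub>GL\<^esub> x = \<one>\<^bsub>GL\<^esub>"
    by (auto intro!: bexI[of _ y] simp: invertible_def)
next
  show "\<one>\<^bsub>GL\<^esub> \<in> carrier (GL :: ('a ^ 'n ^ 'n) monoid)"
    by (auto simp: invertible_def intro!: exI[of _ "mat 1"])
qed (auto simp: invertible_mult matrix_mul_assoc)

lemma matrix_inv_inverse:
  fixes A :: "'a::field ^ 'n::finite ^ 'n"
  assumes "invertible A"
  shows "A ** matrix_inv A = mat 1" "matrix_inv A ** A = mat 1"
  using someI_ex[of "\<lambda>A'. A ** A' = mat 1 \<and> A' ** A = mat 1"] assms
  unfolding invertible_def matrix_inv_def by auto

lemma dual_space_props:
  assumes "f \<in> dual_space"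
  shows "eval_polyfun f (u + v) = eval_polyfun f u + eval_polyfun f v"
    and "eval_polyfun f (u - v) = eval_polyfun f u - eval_polyfun f v"
    and "eval_polyfun f (c *s v) = c * eval_polyfun f v"
    and "eval_polyfun f 0 = 0"
proof -
  interpret Vector_Spaces.linear "(*s)" "(*)" "eval_polyfun f"
    using assms by (simp add: dual_space_def)
  show "eval_polyfun f (u + v) = eval_polyfun f u + eval_polyfun f v"
    "eval_polyfun f (u - v) = eval_polyfun f u - eval_polyfun f v"
    "eval_polyfun f (c *s v) = c * eval_polyfun f v" "eval_polyfun f 0 = 0"
    by (fact add diff scale zero)+
qed

lemma polyfun_eqI: "(\<And>v. eval_polyfun f v = eval_polyfun g v) \<Longrightarrow> f = g"
  by (metis eval_polyfun_inject ext)

lemma act_dual_space: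
  assumes "f \<in> dual_space - {0}" "invertible x"
  shows "act x f \<in> dual_space - {0}"
proof -
  have "Vector_Spaces.linear (*s) (*) (eval_polyfun f \<circ> (*v) (matrix_inv x))"
    using assms by (intro Vector_Spaces.linear_compose[of "(*s)" "(*s)"]) (auto simp: dual_space_def)
  then have "act x f \<in> dual_space"
    by (simp add: dual_space_def act.rep_eq o_def)
  moreover have "act x f \<noteq> 0"
  proof
    assume "act x f = 0"
    then have "eval_polyfun f (matrix_inv x *v (x *v v)) = 0" for v
      by (metis act.rep_eq zero_polyfun.rep_eq)
    then have "eval_polyfun f v = 0" for v
      by (simp add: matrix_vector_mul_assoc matrix_inv_inverse assms)
    then have "f = 0"
      by (intro polyfun_eqI) (simp add: zero_polyfun.rep_eq)
    then show False using assms by simp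
  qed
  ultimately show ?thesis by simp
qed

lemma coroot_kernel:
  assumes "coroots W l" "s \<in> pseudo_reflections W" "eval_polyfun (l s) u = 0"
  shows "u \<in> fixed_space s"
proof (rule ccontr)
  assume u: "u \<notin> fixed_space s"
  have ls: "l s \<in> dual_space" "l s \<noteq> 0" "\<And>v. v \<in> fixed_space s \<Longrightarrow> eval_polyfun (l s) v = 0"
    using assms by (auto simp: coroots_def)
  have sub: "vec.subspace (fixed_space s)"
    by (auto simp: vec.subspace_def fixed_space_def matrix_vector_right_distrib
        vector_scalar_commute)
  have "vec.dim (insert u (fixed_space s)) = CARD('b)"
    using assms(2) u sub by (simp add: vec.dim_insert vec.span_eq_iff[THEN iffD2] pseudo_reflections_def)
  then have "vec.span (insert u (fixed_space s)) = UNIV"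
    by (subst vec.dim_eq_full[symmetric]) (simp add: vec.dimension_def card_cart_basis)
  moreover have "vec.span (insert u (fixed_space s)) \<subseteq> {v. eval_polyfun (l s) v = 0}"
    using ls assms(3) by (intro vec.span_minimal)
      (auto simp: vec.subspace_def dual_space_props)
  ultimately have "l s = 0"
    by (intro polyfun_eqI) (auto simp: zero_polyfun.rep_eq)
  with ls show False by simp
qed

lemma L_inj:
  fixes W :: "('a::field ^ 'n::finite ^ 'n) set"
  assumes W: "subgroup W GL" "finite W" "of_nat (card W) \<noteq> (0::'a)"
    and l: "coroots W l" and s: "s \<in> pseudo_reflections W" and x: "x \<in> W"
  shows "inj_on (L l s) (right_orbit s x)"
proof -
  interpret group "GL :: ('a ^ 'n ^ 'n) monoid" by (rule group_GL)
  interpret W: group "GL\<lparr>carrier := W\<rparr>"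
    using W(1) group_GL by (rule subgroup.subgroup_is_group)
  have sW: "s \<in> W" using s by (simp add: pseudo_reflections_def)
  have inv: "invertible y" if "y \<in> W" for y
    using subgroup.subset[OF W(1)] that by auto
  have pow_W: "s [^]\<^bsub>GL\<^esub> j \<in> W" for j :: nat
    using W.nat_pow_closed[of s j] sW by (simp add: nat_pow_consistent[symmetric])
  have sN: "s [^]\<^bsub>GL\<^esub> card W = mat 1"
    using W.pow_order_eq_1[of s] sW by (simp add: order_def nat_pow_consistent[symmetric])
  have ls: "l s \<in> dual_space" "\<And>v. v \<in> fixed_space s \<Longrightarrow> eval_polyfun (l s) v = 0"
    using l s by (auto simp: coroots_def)
  have key: "i = j"
    if ij: "i \<le> j" "j < ord s"
      and eq: "L l s (x ** (s [^]\<^bsub>GL\<^esub> i)) = L l s (x ** (s [^]\<^bsub>GL\<^esub> j))" for i j :: nat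
  proof -
    define a where "a = x ** (s [^]\<^bsub>GL\<^esub> i)"
    define t where "t = s [^]\<^bsub>GL\<^esub> (j - i)"
    have inv_a: "invertible a"
      unfolding a_def using inv x pow_W by (intro invertible_mult) auto
    have inv_t: "invertible t" unfolding t_def using inv pow_W by auto
    have b: "x ** (s [^]\<^bsub>GL\<^esub> j) = a ** t"
      using nat_pow_mult[of s i "j - i"] ij inv[OF sW]
      by (simp add: a_def t_def matrix_mul_assoc[symmetric])
    have inv_at: "matrix_inv (a ** t) ** (a ** t) = mat 1"
      by (intro matrix_inv_inverse invertible_mult inv_a inv_t)
    have t_l: "eval_polyfun (l s) (t *v u) = eval_polyfun (l s) u" for u
    proof -
      have "eval_polyfun (act a (l s)) ((a ** t) *v u) = eval_polyfun (act (a ** t) (l s)) ((a ** t) *v u)"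
        using eq b by (simp add: L_def a_def)
      then show ?thesis
        by (simp only: act.rep_eq matrix_vector_mul_assoc inv_at)
           (simp add: matrix_mul_assoc matrix_inv_inverse[OF inv_a])
    qed
    have s_fix: "(s [^]\<^bsub>GL\<^esub> k) *v v = v" if "v \<in> fixed_space s" for v and k :: nat
      using that by (induction k) (auto simp: fixed_space_def matrix_vector_mul_assoc[symmetric])
    have "t *v u = u" for u
    proof -
      define d where "d = t *v u - u"
      have "eval_polyfun (l s) d = 0"
        using ls by (simp add: d_def dual_space_props t_l)
      then have d: "d \<in> fixed_space s" by (rule coroot_kernel[OF l s])
      have "(t [^]\<^bsub>GL\<^esub> k) *v u = u + of_nat k *s d" for k :: nat
      proof (induction k)
        case (Suc k)
        have "(t [^]\<^bsub>GL\<^esub> Suc k) *v u = (t [^]\<^bsub>GL\<^esub> k) *v (u + d)"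
          by (simp add: matrix_vector_mul_assoc[symmetric] d_def)
        also have "(t [^]\<^bsub>GL\<^esub> k) *v d = d"
          using s_fix[OF d] inv[OF sW] by (simp add: t_def nat_pow_pow)
        then have "(t [^]\<^bsub>GL\<^esub> k) *v (u + d) = u + of_nat (Suc k) *s d"
          using Suc by (simp add: matrix_vector_right_distrib algebra_simps)
        finally show ?case .
      qed simp
      moreover have "t [^]\<^bsub>GL\<^esub> card W = mat 1"
      proof -
        have "t [^]\<^bsub>GL\<^esub> card W = (s [^]\<^bsub>GL\<^esub> card W) [^]\<^bsub>GL\<^esub> (j - i)"
          using inv[OF sW] by (simp add: t_def nat_pow_pow mult.commute)
        then show ?thesis using sN nat_pow_one[of "j - i"] by simp
      qed
      ultimately have "u = u + of_nat (card W) *s d"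
        by (metis matrix_vector_mul_lid)
      then have "d = 0" using W(3) by (simp add: vec.scale_eq_0_iff)
      then show ?thesis by (simp add: d_def)
    qed
    then have "t = mat 1" by (simp add: matrix_eq)
    then have "ord s dvd j - i"
      using pow_eq_id[of s "j - i"] inv[OF sW] by (simp add: t_def)
    then show "i = j" using ij by (auto dest: dvd_imp_le)
  qed
  show ?thesis
  proof (rule inj_onI)
    fix y z
    assume "y \<in> right_orbit s x" "z \<in> right_orbit s x" and eq: "L l s y = L l s z"
    then obtain i j where y: "y = x ** (s [^]\<^bsub>GL\<^esub> i)" "i < ord s"
      and z: "z = x ** (s [^]\<^bsub>GL\<^esub> j)" "j < ord s"
      by (auto simp: right_orbit_def)
    show "y = z"
      using key[of i j] key[of j i] y z eq by (cases "i \<le> j") auto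
  qed
qed

lemma act_pow_coroot:
  fixes W :: "('a::field ^ 'n::finite ^ 'n) set"
  assumes W: "subgroup W GL" and l: "coroots W l" and s: "s \<in> pseudo_reflections W"
    and x: "x \<in> W"
  shows "L l s (x ** (s [^]\<^bsub>GL\<^esub> (j::nat))) \<in> scalar_line (act x (l s))"
proof -
  interpret group "GL :: ('a ^ 'n ^ 'n) monoid" by (rule group_GL)
  have inv: "invertible y" if "y \<in> W" for y
    using subgroup.subset[OF W] that by auto
  have inv_s: "invertible s" using s inv by (simp add: pseudo_reflections_def)
  define t where "t = s [^]\<^bsub>GL\<^esub> j"
  have inv_t: "invertible t" using nat_pow_closed[of s j] inv_s by (simp add: t_def)
  have ls: "l s \<in> dual_space" "l s \<noteq> 0" "\<And>v. v \<in> fixed_space s \<Longrightarrow> eval_polyfun (l s) v = 0"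
    using l s by (auto simp: coroots_def)
  then obtain u where u: "eval_polyfun (l s) u \<noteq> 0"
    by (metis polyfun_eqI zero_polyfun.rep_eq)
  have t_fix: "matrix_inv t *v v = v" if "v \<in> fixed_space s" for v
  proof -
    have "t *v v = v" unfolding t_def using that
      by (induction j) (auto simp: fixed_space_def matrix_vector_mul_assoc[symmetric])
    then show ?thesis
      by (metis inv_t matrix_inv_inverse(2) matrix_vector_mul_assoc matrix_vector_mul_lid)
  qed
  define c where "c = eval_polyfun (l s) (matrix_inv t *v u) / eval_polyfun (l s) u"
  have t_l: "eval_polyfun (l s) (matrix_inv t *v v) = c * eval_polyfun (l s) v" for v
  proof -
    define r where "r = eval_polyfun (l s) v / eval_polyfun (l s) u"
    have "eval_polyfun (l s) (v - r *s u) = 0"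
      using u by (simp add: r_def dual_space_props ls)
    then have fx: "v - r *s u \<in> fixed_space s" by (rule coroot_kernel[OF l s])
    have "matrix_inv t *v v = matrix_inv t *v (v - r *s u) + r *s (matrix_inv t *v u)"
      by (simp add: vec.diff vec.scale)
    then have "matrix_inv t *v v = (v - r *s u) + r *s (matrix_inv t *v u)"
      using t_fix[OF fx] by simp
    then have "eval_polyfun (l s) (matrix_inv t *v v) =
        eval_polyfun (l s) (v - r *s u) + r * eval_polyfun (l s) (matrix_inv t *v u)"
      by (metis dual_space_props(1,3) ls(1))
    also have "\<dots> = c * eval_polyfun (l s) v"
      using ls fx u by (simp add: c_def r_def)
    finally show ?thesis .
  qed
  have "matrix_inv (x ** t) = matrix_inv t ** matrix_inv x"
  proof -
    have "matrix_inv t ** matrix_inv x ** (x ** t) = mat 1"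
      by (metis inv[OF x] inv_t matrix_inv_inverse(2) matrix_mul_assoc matrix_mul_lid)
    moreover have "(x ** t) ** matrix_inv (x ** t) = mat 1"
      by (intro matrix_inv_inverse invertible_mult inv x inv_t)
    ultimately show ?thesis
      by (metis matrix_mul_assoc matrix_mul_lid matrix_mul_rid)
  qed
  then have "L l s (x ** t) = const_polyfun c * act x (l s)"
    by (intro polyfun_eqI) (simp add: L_def act.rep_eq times_polyfun.rep_eq const_polyfun.rep_eq
        matrix_vector_mul_assoc[symmetric] t_l)
  then show ?thesis by (auto simp: scalar_line_def t_def)
qed

lemma ex_orbit_presentation: "\<exists>p. orbit_presentation W p"
proof -
  have "\<forall>e \<in> W_hyperedges W. \<exists>q. case q of (s, x) \<Rightarrow>
      s \<in> pseudo_reflections W \<and> x \<in> W \<and> e = right_orbit s x"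
    by (auto simp: W_hyperedges_def)
  then show ?thesis
    unfolding orbit_presentation_def by (rule bchoice)
qed

theorem linear_hypergraph_W:
  fixes W :: "('a::field ^ 'n::finite ^ 'n) set"
  assumes W: "subgroup W GL" "finite W" "of_nat (card W) \<noteq> (0::'a)"
    and l: "coroots W l" and p: "orbit_presentation W p"
  shows "linear_hypergraph (W_hypergraph W l p)"
proof -
  interpret group "GL :: ('a ^ 'n ^ 'n) monoid" by (rule group_GL)
  interpret W: group "GL\<lparr>carrier := W\<rparr>"
    using W(1) group_GL by (rule subgroup.subgroup_is_group)
  have orbit_sub: "right_orbit s x \<subseteq> W" if "s \<in> pseudo_reflections W" "x \<in> W" for s x
  proof -
    have "s \<in> W" using that by (simp add: pseudo_reflections_def)
    then have "s [^]\<^bsub>GL\<^esub> j \<in> W" for j :: nat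
      using W.nat_pow_closed[of s j] by (simp add: nat_pow_consistent[symmetric])
    then show ?thesis
      using subgroup.m_closed[OF W(1) that(2)] by (auto simp: right_orbit_def)
  qed
  show ?thesis
    unfolding linear_hypergraph_def
  proof (intro conjI ballI)
    show "finite (vertices (W_hypergraph W l p))"
      by (simp add: W_hypergraph_def W)
    show "hyperedges (W_hypergraph W l p) \<subseteq> Pow (vertices (W_hypergraph W l p))"
      using orbit_sub by (auto simp: W_hypergraph_def W_hyperedges_def)
  next
    fix e
    assume "e \<in> hyperedges (W_hypergraph W l p)"
    then have e: "e \<in> W_hyperedges W" by (simp add: W_hypergraph_def)
    obtain s x where q: "p e = (s, x)" by fastforce
    then have sx: "s \<in> pseudo_reflections W" "x \<in> W" "e = right_orbit s x"
      using p e by (auto simp: orbit_presentation_def)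
    have ax: "axial (W_hypergraph W l p) e = scalar_line (act x (l s))"
      and gen: "gen_class (W_hypergraph W l p) e = restrict (L l s) e"
      by (simp_all add: W_hypergraph_def q)
    have "invertible x" using subgroup.subset[OF W(1)] sx by auto
    moreover have "l s \<in> dual_space - {0}" using l sx by (simp add: coroots_def)
    ultimately show "axial (W_hypergraph W l p) e \<in> proj_dual"
      unfolding ax proj_dual_def by (intro imageI act_dual_space)
    show "gen_class (W_hypergraph W l p) e \<in> Maps e (axial (W_hypergraph W l p) e)"
      using act_pow_coroot[OF W(1) l sx(1,2)]
      unfolding ax gen Maps_def by (intro restrict_PiE_iff[THEN iffD2]) (auto simp: sx(3) right_orbit_def)
    show "inj_on (gen_class (W_hypergraph W l p) e) e"
      unfolding gen using L_inj[OF W l sx(1,2)] sx(3) by simp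
  qed
qed

end

theory Submission
  imports Defs
begin

text \<open>
  Both sides impose one condition for every right orbit \<open>x, xs, \<dots>, xs\<^bsup>m-1\<^esup>\<close>, where
  \<open>m\<close> is the order of the pseudo-reflection \<open>s\<close>, and the two conditions on an orbit are
  related by the finite Fourier transform on the cyclic group generated by \<open>s\<close>.

  Since \<open>s\<close> fixes a hyperplane, it multiplies its co-root by a scalar \<open>z\<close>, and \<open>z\<close> is a
  primitive \<open>m\<close>-th root of unity (lemma \<open>primitive_eigenvalue\<close>).  With
  \<open>Y = x(l\<^sub>s)\<close> and \<open>a\<^sub>j = F(xs\<^sup>j)\<close> the values of \<open>L\<^sub>s\<close> along the orbit are
  \<open>z\<^sup>j Y\<close>, and the sums defining \<open>HW\<close> are
  \<open>c\<^sub>i = \<Sum>\<^sub>j a\<^sub>j / (z\<^sup>j Y)\<^sup>i\<close>.  By orthogonality of the powers of \<open>z\<close>, the numbers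
  \<open>c\<^sub>i / m\<close> for \<open>0 \<le> i < m\<close> are exactly the coefficients of the unique polynomial of
  degree less than \<open>m\<close> over the field of fractions that takes the value \<open>a\<^sub>j\<close> at
  \<open>z\<^sup>j Y\<close> for all \<open>j\<close>.  As \<open>m\<close> divides the order of \<open>W\<close>, it is invertible in \<open>R\<close>; hence all
  \<open>c\<^sub>i\<close> lie in \<open>R\<close> if and only if the interpolating polynomial has coefficients in \<open>R\<close>,
  which is membership in the cohomology of the hyperedge.  For negative \<open>i\<close> the sum
  \<open>c\<^sub>i\<close> is a polynomial function whatever \<open>F\<close> is.  This is \<open>integral_power_sums_iff\<close>.

  One point remains: the hypergraph uses only one pair \<open>(s, x)\<close> for each hyperedge, whereas
  \<open>HW\<close> refers to all of them.  Two pseudo-reflections with a common orbit have the same fixed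
  hyperplane, so their co-roots are proportional and give the same cohomology
  (lemma \<open>edge_cohomology_presentation_independent\<close>).
\<close>

section \<open>Fourier analysis on a cyclic group\<close>

text \<open>Orthogonality of the characters of a cyclic group of order \<open>m\<close>: the summand is the
  \<open>j\<close>-th power of \<open>z\<^bsup>k-i\<^esup>\<close>, an \<open>m\<close>-th root of unity that differs from 1 unless
  \<open>i = k\<close>, so the geometric sum vanishes.\<close>

lemma sum_powers_primitive_root:
  fixes z :: "'k::field"
  assumes "z ^ m = 1" and prim: "\<And>d. 0 < d \<Longrightarrow> d < m \<Longrightarrow> z ^ d \<noteq> 1"
    and "i < m" "k < m"
  shows "(\<Sum>j<m. (z ^ j) ^ k / (z ^ j) ^ i) = (if i = k then of_nat m else 0)"
proof -
  have z0: "z \<noteq> 0" using assms(1,3) by (auto simp: power_0_left split: if_splits)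
  define q where "q = z ^ k / z ^ i"
  have "(z ^ j) ^ k / (z ^ j) ^ i = q ^ j" for j
    by (simp add: q_def power_divide power_mult[symmetric] mult.commute)
  then have sum: "(\<Sum>j<m. (z ^ j) ^ k / (z ^ j) ^ i) = (\<Sum>j<m. q ^ j)" by simp
  have "q \<noteq> 1" if "i \<noteq> k"
  proof
    assume "q = 1"
    then have eq: "z ^ k = z ^ i" using z0 by (simp add: q_def)
    have *: "z ^ (b - a) = 1" if "z ^ b = z ^ a" "a < b" for a b
      using that z0 by (simp add: power_diff)
    show False
      using *[of k i] *[of i k] prim[of "k - i"] prim[of "i - k"] eq that assms(3,4)
      by (cases "i < k") auto
  qed
  moreover have "q ^ m = 1"
  proof -
    have "(z ^ n) ^ m = 1" for n
      using assms(1) by (metis power_mult mult.commute power_one)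
    then show ?thesis by (simp add: q_def power_divide)
  qed
  moreover have "q = 1" if "i = k"
    using that z0 by (simp add: q_def)
  ultimately show ?thesis
    by (auto simp: sum geometric_sum)
qed

text \<open>Substituting the expansion of \<open>a j\<close>, orthogonality kills all terms except \<open>k = i\<close>, and
  there the powers of \<open>Y\<close> cancel.\<close>

lemma power_sum_of_interpolant:
  fixes z Y :: "'k::field"
  assumes "z ^ m = 1" "\<And>d. 0 < d \<Longrightarrow> d < m \<Longrightarrow> z ^ d \<noteq> 1" "Y \<noteq> 0" "i < m"
    and a: "\<And>j. j < m \<Longrightarrow> a j = (\<Sum>k<m. g k * (z ^ j * Y) ^ k)"
  shows "(\<Sum>j<m. a j / (z ^ j * Y) ^ i) = of_nat m * g i"
proof -
  have "(\<Sum>j<m. a j / (z ^ j * Y) ^ i)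
      = (\<Sum>j<m. \<Sum>k<m. g k * (Y ^ k / Y ^ i) * ((z ^ j) ^ k / (z ^ j) ^ i))"
    by (intro sum.cong refl) (simp add: a sum_divide_distrib power_mult_distrib mult_ac)
  also have "\<dots> = (\<Sum>k<m. g k * (Y ^ k / Y ^ i) * (\<Sum>j<m. (z ^ j) ^ k / (z ^ j) ^ i))"
    by (subst sum.swap) (simp add: sum_distrib_left)
  also have "\<dots> = (\<Sum>k<m. if i = k then of_nat m * g i else 0)"
    using assms(3) by (intro sum.cong refl)
      (auto simp: sum_powers_primitive_root[OF assms(1,2) \<open>i < m\<close>])
  finally show ?thesis using \<open>i < m\<close> by simp
qed

text \<open>Fourier inversion.  The powers of \<open>Y\<close> cancel at once, and orthogonality is applied with the
  roles of exponents and points exchanged.\<close>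

lemma interpolation_from_power_sums:
  fixes z Y :: "'k::field"
  assumes "z ^ m = 1" "\<And>d. 0 < d \<Longrightarrow> d < m \<Longrightarrow> z ^ d \<noteq> 1" "Y \<noteq> 0" "j < m"
  shows "(\<Sum>i<m. (\<Sum>n<m. a n / (z ^ n * Y) ^ i) * (z ^ j * Y) ^ i) = of_nat m * a j"
proof -
  have "(\<Sum>i<m. (\<Sum>n<m. a n / (z ^ n * Y) ^ i) * (z ^ j * Y) ^ i)
      = (\<Sum>i<m. \<Sum>n<m. a n * ((z ^ i) ^ j / (z ^ i) ^ n))"
    unfolding sum_distrib_right using assms(3)
    by (intro sum.cong refl)
       (simp add: power_mult_distrib power_mult[symmetric] mult_ac)
  also have "\<dots> = (\<Sum>n<m. a n * (\<Sum>i<m. (z ^ i) ^ j / (z ^ i) ^ n))"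
    by (subst sum.swap) (simp add: sum_distrib_left)
  also have "\<dots> = (\<Sum>n<m. if n = j then of_nat m * a j else 0)"
    by (intro sum.cong refl) (auto simp: sum_powers_primitive_root[OF assms(1,2) _ \<open>j < m\<close>])
  finally show ?thesis using \<open>j < m\<close> by simp
qed

lemma to_fract_power: "to_fract (r ^ k) = to_fract r ^ k"
  by (induction k) simp_all

lemma to_fract_of_nat: "to_fract (of_nat k) = of_nat k"
  by (induction k) simp_all

text \<open>The bridge between the two sides.  Inside the field of fractions the power sums are \<open>m\<close> times
  the coefficients of the interpolating polynomial, and \<open>m\<close> is a unit of the ring (with inverse
  \<open>c\<close>), so integrality passes from one to the other.\<close>

lemma integral_power_sums_iff:
  fixes w Y c :: "'r::idom" and A :: "nat \<Rightarrow> 'r"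
  assumes w: "w ^ m = 1" "\<And>d. 0 < d \<Longrightarrow> d < m \<Longrightarrow> w ^ d \<noteq> 1" and c: "c * of_nat m = 1" and Y: "Y \<noteq> 0"
  shows "(\<forall>i::int. i \<le> int m - 1 \<longrightarrow>
      (\<Sum>j<m. Fract (A j) 1 / Fract (w ^ j * Y) 1 powi i) \<in> integral_fracts) \<longleftrightarrow>
    (\<exists>g. \<forall>j<m. A j = (\<Sum>i<m. g i * (w ^ j * Y) ^ i))"
    (is "?integral \<longleftrightarrow> ?interpolated")
proof -
  define z y where "z = to_fract w" and "y = to_fract Y"
  have z: "z ^ m = 1" "\<And>d. 0 < d \<Longrightarrow> d < m \<Longrightarrow> z ^ d \<noteq> 1" and y: "y \<noteq> 0"
    using w Y to_fract_eq_iff[of _ "1::'r"]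
    by (simp_all add: z_def y_def del: to_fract_eq_iff flip: to_fract_power)
  have t: "to_fract (w ^ j * Y) = z ^ j * y" for j
    by (simp add: z_def y_def to_fract_power)
  have t_pow: "to_fract ((w ^ j * Y) ^ k) = (z ^ j * y) ^ k" for j k
    by (simp only: to_fract_power t)
  have integral: "x \<in> integral_fracts \<longleftrightarrow> (\<exists>r. x = to_fract r)" for x :: "'r fract"
    by (auto simp: integral_fracts_def to_fract_def)
  let ?S = "\<lambda>i::int. \<Sum>j<m. to_fract (A j) / (z ^ j * y) powi i"
  have "?integral \<longleftrightarrow> (\<forall>i::int. i \<le> int m - 1 \<longrightarrow> ?S i \<in> integral_fracts)"
    by (simp add: to_fract_def[symmetric] t del: to_fract_mult)
  also have "\<dots> \<longleftrightarrow> ?interpolated"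
  proof
    assume int: "\<forall>i::int. i \<le> int m - 1 \<longrightarrow> ?S i \<in> integral_fracts"
    have "\<exists>r. i < m \<longrightarrow> ?S (int i) = to_fract r" for i
      using int[rule_format, of "int i"] by (auto simp: integral)
    then obtain r where r: "\<And>i. i < m \<Longrightarrow> ?S (int i) = to_fract (r i)" by metis
    have "A j = (\<Sum>i<m. c * r i * (w ^ j * Y) ^ i)" if "j < m" for j
    proof -
      have "to_fract (\<Sum>i<m. r i * (w ^ j * Y) ^ i)
          = (\<Sum>i<m. (\<Sum>n<m. to_fract (A n) / (z ^ n * y) ^ i) * (z ^ j * y) ^ i)"
        using r by (simp add: t_pow)
      also have "\<dots> = to_fract (of_nat m * A j)"
        by (simp add: interpolation_from_power_sums[OF z y that] to_fract_of_nat)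
      finally have "(\<Sum>i<m. r i * (w ^ j * Y) ^ i) = of_nat m * A j"
        by (simp only: to_fract_eq_iff)
      then have "(\<Sum>i<m. c * r i * (w ^ j * Y) ^ i) = (c * of_nat m) * A j"
        by (simp add: sum_distrib_left[symmetric] mult.assoc)
      then show ?thesis by (simp add: c)
    qed
    then show ?interpolated by (intro exI[of _ "\<lambda>i. c * r i"]) blast
  next
    assume ?interpolated
    then obtain g where g: "\<And>j. j < m \<Longrightarrow> A j = (\<Sum>i<m. g i * (w ^ j * Y) ^ i)" by blast
    have a: "to_fract (A j) = (\<Sum>k<m. to_fract (g k) * (z ^ j * y) ^ k)" if "j < m" for j
      by (simp add: g[OF that] t_pow)
    show "\<forall>i::int. i \<le> int m - 1 \<longrightarrow> ?S i \<in> integral_fracts"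
    proof (intro allI impI)
      fix i :: int
      assume i: "i \<le> int m - 1"
      show "?S i \<in> integral_fracts"
      proof (cases "i < 0")
        case True
        \<comment> \<open>Dividing by a negative power means multiplying, so the sum has no denominators.\<close>
        then obtain k where k: "i = - int k" by (intro that[of "nat (- i)"]) simp
        have "?S i = to_fract (\<Sum>j<m. A j * (w ^ j * Y) ^ k)"
          by (simp add: k power_int_minus t_pow divide_inverse)
        then show ?thesis using integral by blast
      next
        case False
        with i obtain k where k: "i = int k" "k < m" by (intro that[of "nat i"]) auto
        have "?S i = to_fract (of_nat m * g k)"
          using power_sum_of_interpolant[OF z y k(2) a] k by (simp add: to_fract_of_nat)
        then show ?thesis using integral by blast
      qed
    qed
  qed
  finally show ?thesis .
qed

section \<open>A pseudo-reflection acts on its co-root by a primitive root of unity\<close>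

lemma matrix_inv_mult:
  fixes x y :: "'a::field ^ 'n::finite ^ 'n"
  assumes "invertible x" "invertible y"
  shows "matrix_inv (x ** y) = matrix_inv y ** matrix_inv x"
proof -
  have "matrix_inv y ** matrix_inv x ** (x ** y) = mat 1"
    by (metis assms matrix_inv_inverse(2) matrix_mul_assoc matrix_mul_lid)
  moreover have "(x ** y) ** matrix_inv (x ** y) = mat 1"
    by (intro matrix_inv_inverse invertible_mult assms)
  ultimately show ?thesis
    by (metis matrix_mul_assoc matrix_mul_lid matrix_mul_rid)
qed

lemma act_mult:
  assumes "invertible x" "invertible y"
  shows "act (x ** y) f = act x (act y f)"
  by (intro polyfun_eqI)
     (simp add: act.rep_eq matrix_inv_mult[OF assms] matrix_vector_mul_assoc)

lemma act_one: "act (mat 1) f = f"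
proof -
  have "invertible (mat 1 :: 'a ^ 'b ^ 'b)"
    by (auto simp: invertible_def intro!: exI[of _ "mat 1"])
  then have "matrix_inv (mat 1 :: 'a ^ 'b ^ 'b) = mat 1"
    by (metis matrix_inv_inverse(1) matrix_mul_lid)
  then show ?thesis by (intro polyfun_eqI) (simp add: act.rep_eq)
qed

lemma act_const_mult: "act x (const_polyfun c * f) = const_polyfun c * act x f"
  by (intro polyfun_eqI) (simp add: act.rep_eq times_polyfun.rep_eq const_polyfun.rep_eq)

lemma const_polyfun_one: "const_polyfun 1 = 1"
  by transfer simp

lemma const_polyfun_mult: "const_polyfun (a * b) = const_polyfun a * const_polyfun b"
  by transfer simp

lemma const_polyfun_power: "const_polyfun (a ^ k) = const_polyfun a ^ k"
  by (induction k) (simp_all add: const_polyfun_one const_polyfun_mult)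

lemma const_polyfun_of_nat: "const_polyfun (of_nat k) = of_nat k"
proof (induction k)
  case 0
  show ?case by (intro polyfun_eqI) (simp add: const_polyfun.rep_eq zero_polyfun.rep_eq)
next
  case (Suc k)
  have "const_polyfun (of_nat (Suc k) :: 'a) = (1 + const_polyfun (of_nat k) :: ('a, 'b) polyfun)"
    by transfer simp
  then show ?case using Suc by simp
qed

locale reflection_in_group =
  fixes W :: "('a::alg_closed_field ^ 'n::finite ^ 'n) set"
    and l :: "'a ^ 'n ^ 'n \<Rightarrow> ('a, 'n) polyfun" and s :: "'a ^ 'n ^ 'n"
  assumes W: "subgroup W GL" "finite W" "of_nat (card W) \<noteq> (0::'a)"
    and l: "coroots W l" and s: "s \<in> pseudo_reflections W"
begin

sublocale group "GL :: ('a ^ 'n ^ 'n) monoid" by (rule group_GL)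

lemma invertible_in_W: "x \<in> W \<Longrightarrow> invertible x"
  using subgroup.subset[OF W(1)] by auto

lemma s_in_W: "s \<in> W"
  using s by (simp add: pseudo_reflections_def)

lemma invertible_pow: "invertible (s [^]\<^bsub>GL\<^esub> (j::nat))"
  using nat_pow_closed[of s j] invertible_in_W[OF s_in_W] by simp

lemma ord_dvd_card: "ord s dvd card W"
proof -
  interpret W: group "GL\<lparr>carrier := W\<rparr>"
    using W(1) group_GL by (rule subgroup.subgroup_is_group)
  have "s [^]\<^bsub>GL\<^esub> card W = mat 1"
    using W.pow_order_eq_1[of s] s_in_W by (simp add: order_def nat_pow_consistent[symmetric])
  then show ?thesis
    using pow_eq_id[of s "card W"] invertible_in_W[OF s_in_W] by simp
qed

text \<open>By Lagrange's theorem, invertibility of \<open>|W|\<close> is inherited by \<open>|s|\<close>.\<close>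

lemma of_nat_ord_nonzero: "of_nat (ord s) \<noteq> (0::'a)"
  using ord_dvd_card W(3) by (metis dvdE mult_zero_left of_nat_mult)

lemma pow_inj: "inj_on (\<lambda>j::nat. s [^]\<^bsub>GL\<^esub> j) {..<ord s}"
  by (rule inj_on_subset[OF ord_inj]) (use invertible_in_W[OF s_in_W] in auto)

lemma card_orbit:
  assumes "x \<in> W"
  shows "card (right_orbit s x) = ord s"
proof -
  have "inj_on (\<lambda>j::nat. x \<otimes>\<^bsub>GL\<^esub> s [^]\<^bsub>GL\<^esub> j) {..<ord s}"
  proof (rule inj_onI)
    fix i j :: nat
    assume ij: "i \<in> {..<ord s}" "j \<in> {..<ord s}"
      and "x \<otimes>\<^bsub>GL\<^esub> s [^]\<^bsub>GL\<^esub> i = x \<otimes>\<^bsub>GL\<^esub> s [^]\<^bsub>GL\<^esub> j"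
    then have "s [^]\<^bsub>GL\<^esub> i = s [^]\<^bsub>GL\<^esub> j"
      using invertible_in_W[OF assms] invertible_pow Units_l_cancel[of x] by (simp add: Units_eq)
    then show "i = j" using pow_inj ij by (auto dest: inj_onD)
  qed
  then show ?thesis by (simp add: right_orbit_def card_image)
qed

lemma coroot_nonzero: "l s \<noteq> 0"
  using l s by (simp add: coroots_def)

lemma act_coroot_nonzero: "x \<in> W \<Longrightarrow> act x (l s) \<noteq> 0"
  using act_dual_space[of "l s" x] l s invertible_in_W by (auto simp: coroots_def)

text \<open>The functional \<open>s(l\<^sub>s)\<close> vanishes on the hyperplane of \<open>s\<close>, hence is \<open>z l\<^sub>s\<close>
  for a scalar \<open>z\<close>; iterating gives the values along an orbit.  The scalar has exact order
  \<open>|s|\<close> because \<open>L\<^sub>s\<close> separates the powers of \<open>s\<close>: this is where \<open>|W|\<close> being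
  invertible excludes transvections, which fix their co-root.\<close>

lemma primitive_eigenvalue:
  obtains z where
    "\<And>x j. x \<in> W \<Longrightarrow> L l s (x \<otimes>\<^bsub>GL\<^esub> (s [^]\<^bsub>GL\<^esub> (j::nat))) = const_polyfun z ^ j * act x (l s)"
    "const_polyfun z ^ ord s = (1 :: ('a, 'n) polyfun)"
    "\<And>d. 0 < d \<Longrightarrow> d < ord s \<Longrightarrow> const_polyfun z ^ d \<noteq> (1 :: ('a, 'n) polyfun)"
proof -
  have one: "mat 1 \<in> W" using subgroup.one_closed[OF W(1)] by simp
  have inv_s: "invertible s" by (rule invertible_in_W[OF s_in_W])
  have "act s (l s) \<in> scalar_line (l s)"
    using act_pow_coroot[OF W(1) l s one, of 1] inv_s by (simp add: L_def act_one)
  then obtain z where z: "act s (l s) = const_polyfun z * l s"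
    unfolding scalar_line_def by blast
  have pow: "act (s [^]\<^bsub>GL\<^esub> j) (l s) = const_polyfun z ^ j * l s" for j :: nat
  proof (induction j)
    case (Suc j)
    have "act (s [^]\<^bsub>GL\<^esub> Suc j) (l s) = act (s [^]\<^bsub>GL\<^esub> j) (act s (l s))"
      using act_mult[OF invertible_pow inv_s] by simp
    also have "\<dots> = const_polyfun z * act (s [^]\<^bsub>GL\<^esub> j) (l s)"
      by (simp only: z act_const_mult)
    also have "\<dots> = const_polyfun z ^ Suc j * l s"
      by (simp only: Suc power_Suc mult.assoc)
    finally show ?case .
  qed (simp add: act_one)
  show ?thesis
  proof
    show "L l s (x \<otimes>\<^bsub>GL\<^esub> (s [^]\<^bsub>GL\<^esub> j)) = const_polyfun z ^ j * act x (l s)" if "x \<in> W" for x and j :: nat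
      using act_mult[OF invertible_in_W[OF that] invertible_pow[of j], of "l s"]
      by (simp add: L_def pow act_const_mult flip: const_polyfun_power)
    have "const_polyfun z ^ ord s * l s = l s"
      using pow[of "ord s"] pow_ord_eq_1[of s] inv_s by (simp add: act_one)
    then show "const_polyfun z ^ ord s = (1 :: ('a, 'n) polyfun)"
      using coroot_nonzero by simp
  next
    fix d
    assume d: "0 < d" "d < ord s"
    show "const_polyfun z ^ d \<noteq> (1 :: ('a, 'n) polyfun)"
    proof
      assume "const_polyfun z ^ d = (1 :: ('a, 'n) polyfun)"
      then have eq: "L l s (s [^]\<^bsub>GL\<^esub> d) = L l s (s [^]\<^bsub>GL\<^esub> (0::nat))"
        using pow[of d] pow[of 0] by (simp add: L_def)
      have orbit: "s [^]\<^bsub>GL\<^esub> j \<in> right_orbit s (mat 1)" if "j < ord s" for j :: nat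
        using that by (auto simp: right_orbit_def)
      have "s [^]\<^bsub>GL\<^esub> d = s [^]\<^bsub>GL\<^esub> (0::nat)"
        using d by (intro inj_onD[OF L_inj[OF W l s one] eq] orbit) auto
      then show False using inj_onD[OF pow_inj, of d 0] d by auto
    qed
  qed
qed

text \<open>The condition defining \<open>HW\<close> at a pair \<open>(s, x)\<close> is the cohomology condition on the
  hyperedge presented by this same pair.\<close>

lemma orbit_integrality_iff:
  assumes x: "x \<in> W"
  shows "(\<forall>i::int. i \<le> int (ord s) - 1 \<longrightarrow>
      (\<Sum>j<ord s. Fract (F (x \<otimes>\<^bsub>GL\<^esub> (s [^]\<^bsub>GL\<^esub> j))) 1
        / Fract (L l s (x \<otimes>\<^bsub>GL\<^esub> (s [^]\<^bsub>GL\<^esub> j))) 1 powi i) \<in> integral_fracts) \<longleftrightarrow>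
    restrict F (right_orbit s x) \<in> edge_cohomology (right_orbit s x) (L l s)"
proof -
  obtain z where z:
    "\<And>j. L l s (x \<otimes>\<^bsub>GL\<^esub> (s [^]\<^bsub>GL\<^esub> (j::nat))) = const_polyfun z ^ j * act x (l s)"
    "const_polyfun z ^ ord s = (1 :: ('a, 'n) polyfun)"
    "\<And>d. 0 < d \<Longrightarrow> d < ord s \<Longrightarrow> const_polyfun z ^ d \<noteq> (1 :: ('a, 'n) polyfun)"
    using primitive_eigenvalue x by metis
  have c: "const_polyfun (inverse (of_nat (ord s))) * of_nat (ord s) = (1 :: ('a, 'n) polyfun)"
    using of_nat_ord_nonzero
    by (simp flip: const_polyfun_of_nat const_polyfun_mult add: const_polyfun_one)
  show ?thesis
    unfolding z(1)
    by (rule trans[OF integral_power_sums_iff[OF z(2,3) c act_coroot_nonzero[OF x]]])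
       (simp_all add: edge_cohomology_def Maps_def card_orbit[OF x],
        simp add: right_orbit_def z(1)[simplified] lessThan_def)
qed

end

section \<open>Independence of the presentation of a hyperedge\<close>

lemma dual_space_kernel_le_scalar:
  fixes f g :: "('a::field, 'n::finite) polyfun"
  assumes f: "f \<in> dual_space" and g: "g \<in> dual_space"
    and ker: "\<And>v. eval_polyfun g v = 0 \<Longrightarrow> eval_polyfun f v = 0"
  shows "\<exists>c. f = const_polyfun c * g"
proof (cases "g = 0")
  case True
  then have "f = 0" using ker by (intro polyfun_eqI) (simp add: zero_polyfun.rep_eq)
  then show ?thesis using True by simp
next
  case False
  then obtain u where u: "eval_polyfun g u \<noteq> 0"
    by (metis polyfun_eqI zero_polyfun.rep_eq)
  define c where "c = eval_polyfun f u / eval_polyfun g u"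
  have "eval_polyfun f v = c * eval_polyfun g v" for v
  proof -
    have "eval_polyfun f (v - (eval_polyfun g v / eval_polyfun g u) *s u) = 0"
      using u by (intro ker) (simp add: dual_space_props[OF g])
    then show ?thesis by (simp add: dual_space_props[OF f] c_def)
  qed
  then show ?thesis
    by (intro exI[of _ c] polyfun_eqI) (simp add: times_polyfun.rep_eq const_polyfun.rep_eq)
qed

text \<open>Powers of the factor \<open>c\<close> are absorbed into the coefficients.\<close>

lemma edge_cohomology_rescale:
  assumes "\<And>v. v \<in> e \<Longrightarrow> t v = c * t' v"
  shows "edge_cohomology e t \<subseteq> edge_cohomology e t'"
proof
  fix G
  assume "G \<in> edge_cohomology e t"
  then obtain g where G: "G \<in> Maps e UNIV" "\<And>v. v \<in> e \<Longrightarrow> G v = (\<Sum>i<card e. g i * t v ^ i)"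
    by (auto simp: edge_cohomology_def)
  then have "\<forall>v\<in>e. G v = (\<Sum>i<card e. (g i * c ^ i) * t' v ^ i)"
    using assms by (simp add: power_mult_distrib mult.assoc)
  then show "G \<in> edge_cohomology e t'"
    using G(1) unfolding edge_cohomology_def
    by (intro CollectI conjI exI[of _ "\<lambda>i. g i * c ^ i"])
qed

lemma edge_cohomology_restrict: "edge_cohomology e (restrict t e) = edge_cohomology e t"
  by (simp add: edge_cohomology_def cong: ball_cong)

lemma fixed_space_pow:
  assumes "v \<in> fixed_space s"
  shows "v \<in> fixed_space (s [^]\<^bsub>GL\<^esub> (k::nat))"
  using assms by (induction k) (auto simp: fixed_space_def matrix_vector_mul_assoc[symmetric])

text \<open>A common orbit forces \<open>x' = x s\<^sup>a\<close> and \<open>x' s' = x s\<^sup>b\<close>.  On the hyperplane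
  fixed by \<open>s\<close> both \<open>x'\<close> and \<open>x' s'\<close> therefore act as \<open>x\<close>, so \<open>s'\<close> fixes this hyperplane
  too, and \<open>l\<^bsub>s'\<^esub>\<close> vanishes on the kernel of \<open>l\<^sub>s\<close>.\<close>

lemma coroots_of_equal_orbits:
  fixes W :: "('a::alg_closed_field ^ 'n::finite ^ 'n) set"
  assumes W: "subgroup W GL" "finite W" "of_nat (card W) \<noteq> (0::'a)" and l: "coroots W l"
    and s: "s \<in> pseudo_reflections W" "x \<in> W" and s': "s' \<in> pseudo_reflections W" "x' \<in> W"
    and eq: "right_orbit s x = right_orbit s' x'"
  shows "\<exists>c. l s' = const_polyfun c * l s"
proof -
  interpret reflection_in_group W l s by (intro reflection_in_group.intro W l s(1))
  interpret s': reflection_in_group W l s' by (intro reflection_in_group.intro W l s'(1))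
  \<comment> \<open>An orbit is indexed by exponents below the order, so \<open>x' s'\<close> is listed in its orbit under
    the exponent 1 only because \<open>s'\<close> is not the identity.\<close>
  have ord2: "1 < ord s'"
  proof -
    have "ord s' \<noteq> 0" using s'.of_nat_ord_nonzero by (intro notI) simp
    moreover have "ord s' \<noteq> 1"
      using s'(1) ord_eq_1[of s'] s'.invertible_in_W[OF s'.s_in_W]
      by (auto simp: pseudo_reflections_def)
    ultimately show ?thesis by simp
  qed
  have "x' \<in> right_orbit s' x'"
    using ord2 unfolding right_orbit_def by (intro image_eqI[of _ _ 0]) auto
  moreover have "x' ** s' \<in> right_orbit s' x'"
    using ord2 s'.invertible_in_W[OF s'.s_in_W]
    unfolding right_orbit_def by (intro image_eqI[of _ _ 1]) auto
  ultimately obtain a b where ab: "x' = x ** (s [^]\<^bsub>GL\<^esub> (a::nat))" "x' ** s' = x ** (s [^]\<^bsub>GL\<^esub> (b::nat))"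
    unfolding eq[symmetric] by (auto simp: right_orbit_def)
  have fix_sub: "v \<in> fixed_space s'" if v: "v \<in> fixed_space s" for v
  proof -
    have sv: "s [^]\<^bsub>GL\<^esub> k *v v = v" for k :: nat
      using fixed_space_pow[OF v, of k] by (simp add: fixed_space_def)
    have "x' *v (s' *v v) = x' *v v"
      by (metis ab sv matrix_vector_mul_assoc)
    then show ?thesis
      by (metis (mono_tags, lifting) fixed_space_def mem_Collect_eq invertible_in_W[OF s'(2)]
          matrix_inv_inverse(2) matrix_vector_mul_assoc matrix_vector_mul_lid)
  qed
  show ?thesis
  proof (rule dual_space_kernel_le_scalar)
    show "l s' \<in> dual_space" "l s \<in> dual_space" using l s s' by (auto simp: coroots_def)
    show "eval_polyfun (l s') v = 0" if "eval_polyfun (l s) v = 0" for v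
      using coroot_kernel[OF l s(1) that] fix_sub l s' by (auto simp: coroots_def)
  qed
qed

lemma edge_cohomology_presentation_independent:
  fixes W :: "('a::alg_closed_field ^ 'n::finite ^ 'n) set"
  assumes W: "subgroup W GL" "finite W" "of_nat (card W) \<noteq> (0::'a)" and l: "coroots W l"
    and s: "s \<in> pseudo_reflections W" "x \<in> W" and s': "s' \<in> pseudo_reflections W" "x' \<in> W"
    and eq: "right_orbit s x = right_orbit s' x'"
  shows "edge_cohomology e (L l s) = edge_cohomology e (L l s')"
proof -
  have "edge_cohomology e (L l t) \<subseteq> edge_cohomology e (L l t')"
    if "l t = const_polyfun c * l t'" for t t' c
    by (rule edge_cohomology_rescale[of _ _ "const_polyfun c"]) (simp add: L_def that act_const_mult)
  then show ?thesis
    using coroots_of_equal_orbits[OF assms] coroots_of_equal_orbits[OF W l s' s eq[symmetric]] by blast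
qed

section \<open>The comparison of the two rings\<close>

theorem proposition4p1:
  fixes W :: "('a::alg_closed_field ^ 'n::finite ^ 'n) set"
    and l :: "'a ^ 'n ^ 'n \<Rightarrow> ('a, 'n) polyfun"
    and p :: "('a ^ 'n ^ 'n) set \<Rightarrow> ('a ^ 'n ^ 'n) \<times> ('a ^ 'n ^ 'n)"
  assumes "pseudo_reflection_group W" and "finite W" and "of_nat (card W) \<noteq> (0::'a)"
    and "coroots W l"
    and "orbit_presentation W p"
  shows "HW W l = hypergraph_cohomology (W_hypergraph W l p)"
proof -
  have W: "subgroup W GL" using assms(1) by (simp add: pseudo_reflection_group_def)
  \<comment> \<open>The chosen presentation \<open>p e\<close> may be replaced by any presentation of \<open>e\<close>.\<close>
  have edge: "edge_cohomology e (gen_class (W_hypergraph W l p) e) = edge_cohomology e (L l s)"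
    if "s \<in> pseudo_reflections W" "x \<in> W" "e = right_orbit s x" for e s x
  proof -
    obtain s' x' where q: "p e = (s', x')" by fastforce
    have "e \<in> W_hyperedges W" using that by (auto simp: W_hyperedges_def)
    then have s': "s' \<in> pseudo_reflections W" "x' \<in> W" "e = right_orbit s' x'"
      using assms(5) q by (auto simp: orbit_presentation_def)
    have "edge_cohomology e (gen_class (W_hypergraph W l p) e) = edge_cohomology e (L l s')"
      by (simp add: W_hypergraph_def q edge_cohomology_restrict)
    also have "\<dots> = edge_cohomology e (L l s)"
      using edge_cohomology_presentation_independent[OF W assms(2,3,4) s'(1,2) that(1,2)] s'(3) that(3)
      by simp
    finally show ?thesis .
  qed
  have "HW W l = {F \<in> Maps W UNIV. \<forall>x\<in>W. \<forall>s\<in>pseudo_reflections W.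
      restrict F (right_orbit s x) \<in> edge_cohomology (right_orbit s x) (L l s)}"
  proof -
    have "reflection_in_group W l s" if "s \<in> pseudo_reflections W" for s
      by (intro reflection_in_group.intro W assms(2-4) that)
    then show ?thesis
      unfolding HW_def
      by (intro Collect_cong conj_cong ball_cong refl reflection_in_group.orbit_integrality_iff)
  qed
  also have "\<dots> = hypergraph_cohomology (W_hypergraph W l p)"
  proof -
    have "(\<forall>e\<in>W_hyperedges W. restrict F e \<in> edge_cohomology e (gen_class (W_hypergraph W l p) e))
        \<longleftrightarrow> (\<forall>x\<in>W. \<forall>s\<in>pseudo_reflections W.
          restrict F (right_orbit s x) \<in> edge_cohomology (right_orbit s x) (L l s))" for F
      using edge unfolding W_hyperedges_def by blast
    moreover have "vertices (W_hypergraph W l p) = W"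
      "hyperedges (W_hypergraph W l p) = W_hyperedges W"
      by (simp_all add: W_hypergraph_def)
    ultimately show ?thesis by (simp add: hypergraph_cohomology_def)
  qed
  finally show ?thesis .
qed

end
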